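(* Let $A\in\mathbb{R}^{n\times n}$ be Metzler, $J\in\mathbb{R}^{n\times n}$ nonnegative, $\bar T>0$, $d_s\in\mathbb{N}$, $\varepsilon>0$ and $\epsilon>0$. Assume there exist polynomial vectors $\zeta,\gamma:\mathbb{R}\to\mathbb{R}^n$ of degree at most $2d_s$ such that: (i) $\gamma$ is CSOS; (ii) $\zeta(\bar T)-\epsilon\mathbf{1}_n\ge0$; (iii) $-\zeta(\tau)^\top A+\dot\zeta(\tau)^\top-\tau(\bar T-\tau)\gamma(\tau)^\top$ is CSOS (as a polynomial row vector in $\tau$); (iv) $-\zeta(\bar T)^\top J+\zeta(0)^\top-\varepsilon\mathbf{1}_n^\top\ge0$. Then $\zeta(\bar T)\in\mathbb{R}^n_{>0}$, $\zeta(\tau)^\top A-\dot\zeta(\tau)^\top\le0$ for all $\tau\in[0,\bar T]$, $\zeta(\bar T)^\top J-\zeta(0)^\top+\varepsilon\mathbf{1}_n^\top\le0$, and the impulsive system $\dot x=Ax$ ($t\ne t_k$), $x(t_k^+)=Jx(t_k)$ is asymptotically stable under constant dwell-time $\bar T$ (i.e. $t_{k+1}-t_k=\bar T$ for all $k$).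
   Context: A univariate polynomial is a sum of squares (SOS) if it equals $\sum_i q_i(\tau)^2$ for some real polynomials $q_i$; a polynomial vector is componentwise SOS (CSOS) if each component is SOS. A matrix is Metzler if its off-diagonal entries are nonnegative and nonnegative if all its entries are. Vector inequalities are componentwise; $\mathbf{1}_n$ is the vector of ones. In the impulsive system $x(t^+)=\lim_{s\downarrow t}x(s)$, and asymptotic stability means global asymptotic stability of the zero solution. *)

theory Defs
  imports "HOL-Analysis.Analysis" "HOL-Computational_Algebra.Polynomial"
begin

text \<open>A univariate real polynomial is a sum of squares.\<close>
definition sos_poly :: "real poly \<Rightarrow> bool" where
  "sos_poly p \<longleftrightarrow> (\<exists>qs :: real poly list. p = (\<Sum>q\<leftarrow>qs. q ^ 2))"

text \<open>Componentwise SOS polynomial vector.\<close>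
definition csos :: "real poly ^ 'n \<Rightarrow> bool" where
  "csos v \<longleftrightarrow> (\<forall>i. sos_poly (v $ i))"

definition metzler :: "real ^ 'n ^ 'n \<Rightarrow> bool" where
  "metzler A \<longleftrightarrow> (\<forall>i j. i \<noteq> j \<longrightarrow> 0 \<le> A $ i $ j)"

definition nonneg_mat :: "real ^ 'n ^ 'n \<Rightarrow> bool" where
  "nonneg_mat J \<longleftrightarrow> (\<forall>i j. 0 \<le> J $ i $ j)"

text \<open>Solution (for t \<ge> 0) of the impulsive system
  dx/dt = A x (t \<noteq> t_k), x(t_k^+) = J x(t_k), with impulse times t_k = k T, k \<ge> 1,
  and initial state x(0). On each interval (kT,(k+1)T] the solution coincides with a
  classical solution y of dy/dt = A y on [kT,(k+1)T] started at y(kT) = x(kT^+), where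
  x(0^+) = x(0) and x(kT^+) = J x(kT) for k \<ge> 1.\<close>
definition impulsive_solution ::
  "real ^ 'n ^ 'n \<Rightarrow> real ^ 'n ^ 'n \<Rightarrow> real \<Rightarrow> (real \<Rightarrow> real ^ 'n) \<Rightarrow> bool" where
  "impulsive_solution A J T x \<longleftrightarrow>
     (\<forall>k::nat. \<exists>y :: real \<Rightarrow> real ^ 'n.
        (\<forall>t\<in>{real k * T .. real (Suc k) * T}.
            (y has_vector_derivative (A *v y t)) (at t within {real k * T .. real (Suc k) * T}))
      \<and> y (real k * T) = (if k = 0 then x 0 else J *v x (real k * T))
      \<and> (\<forall>t\<in>{real k * T <.. real (Suc k) * T}. x t = y t))"

text \<open>Global asymptotic stability of the zero solution under constant dwell time T.\<close>
definition impulsive_GAS :: "real ^ 'n ^ 'n \<Rightarrow> real ^ 'n ^ 'n \<Rightarrow> real \<Rightarrow> bool" where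
  "impulsive_GAS A J T \<longleftrightarrow>
     (\<forall>e>0. \<exists>d>0. \<forall>x. impulsive_solution A J T x \<and> norm (x 0) < d \<longrightarrow>
          (\<forall>t\<ge>0. norm (x t) < e))
   \<and> (\<forall>x. impulsive_solution A J T x \<longrightarrow> (x \<longlongrightarrow> 0) at_top)"

end

theory Submission
  imports Defs
begin

text \<open>For Metzler \<open>A\<close> the flow \<open>exp (t A) = exp (- c t) exp (t (A + c I))\<close> is a positive operator.
  Along a nonnegative trajectory the copositive function \<open>\<zeta>(T - s) \<bullet> x(s)\<close> decreases, so the SOS
  conditions make the weighted norm \<open>\<zeta>(T) \<bullet> x\<close> of nonnegative states contract by a factor
  \<open>\<rho> < 1\<close> over one flow-and-jump period. Splitting an arbitrary state into positive and negative
  parts gives geometric decay of all solutions, hence global asymptotic stability.\<close>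

text \<open>\<open>exp (t B) x\<close> as a power series: matrix product does not make \<open>real^'n^'n\<close> a normed algebra,
  so the library exponential is not available.\<close>
definition matrix_exp_apply :: "real^'n^'n \<Rightarrow> real \<Rightarrow> real^'n \<Rightarrow> real^'n" where
  "matrix_exp_apply B t x = (\<Sum>n. (t ^ n / fact n) *\<^sub>R ((*v) B ^^ n) x)"

lemma matrix_vector_mult_bound: "\<exists>K>0. \<forall>x. norm (B *v x) \<le> K * norm (x::real^'n)"
  using bounded_linear.pos_bounded[OF matrix_vector_mul_bounded_linear[of B]]
  by (metis mult.commute)

lemma norm_matrix_exp_term_le:
  fixes B :: "real^'n^'n"
  assumes "\<forall>x. norm (B *v x) \<le> K * norm x" "K \<ge> 0"
  shows "norm ((t ^ n / fact n) *\<^sub>R ((*v) B ^^ n) x) \<le> norm x * ((K * \<bar>t\<bar>) ^ n / fact n)"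
proof -
  have "norm (((*v) B ^^ n) x) \<le> K ^ n * norm x"
  proof (induction n)
    case (Suc n)
    have "norm (((*v) B ^^ Suc n) x) \<le> K * norm (((*v) B ^^ n) x)"
      by (simp add: assms(1))
    also have "\<dots> \<le> K * (K ^ n * norm x)"
      using Suc assms(2) by (intro mult_left_mono) auto
    finally show ?case by simp
  qed simp
  then have "\<bar>t\<bar> ^ n * norm (((*v) B ^^ n) x) \<le> \<bar>t\<bar> ^ n * (K ^ n * norm x)"
    by (intro mult_left_mono) auto
  then show ?thesis
    by (simp add: power_abs power_mult_distrib divide_simps mult_ac)
qed

lemma summable_exp_series: "summable (\<lambda>n. (a::real) ^ n / fact n)"
  using summable_exp[of a] by (simp add: divide_inverse mult.commute)

lemma summable_matrix_exp_series:
  fixes B :: "real^'n^'n"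
  shows "summable (\<lambda>n. (t ^ n / fact n) *\<^sub>R ((*v) B ^^ n) x)"
proof -
  obtain K where K: "K > 0" "\<forall>v. norm (B *v v) \<le> K * norm (v::real^'n)"
    using matrix_vector_mult_bound by blast
  show ?thesis
    by (rule summable_comparison_test[OF _ summable_mult[OF summable_exp_series, of "norm x"]])
      (use norm_matrix_exp_term_le[OF K(2)] K(1) in auto)
qed

lemma matrix_exp_apply_nth:
  "matrix_exp_apply B t x $ i = (\<Sum>n. ((*v) B ^^ n) x $ i / fact n * t ^ n)"
  unfolding matrix_exp_apply_def
  by (simp add: bounded_linear.suminf[OF bounded_linear_vec_nth summable_matrix_exp_series] mult_ac)

lemma summable_matrix_exp_nth:
  fixes B :: "real^'n^'n"
  shows "summable (\<lambda>n. ((*v) B ^^ n) x $ i / fact n * t ^ n)"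
  using bounded_linear.summable[OF bounded_linear_vec_nth summable_matrix_exp_series]
  by (simp add: mult_ac)

lemma matrix_exp_apply_0 [simp]: "matrix_exp_apply B 0 x = x"
proof -
  have "(\<lambda>n. (0 ^ n / fact n) *\<^sub>R ((*v) B ^^ n) x) = (\<lambda>n. if n = 0 then x else 0)"
    by auto
  then show ?thesis
    using sums_single[of 0 "\<lambda>_. x"] by (simp add: matrix_exp_apply_def sums_iff)
qed

lemma matrix_exp_apply_diff:
  "matrix_exp_apply B t (x - y) = matrix_exp_apply B t x - matrix_exp_apply B t y"
proof -
  have "((*v) B ^^ n) (x - y) = ((*v) B ^^ n) x - ((*v) B ^^ n) y" for n
    by (induction n) (simp_all add: matrix_vector_mult_diff_distrib)
  then show ?thesis
    by (simp add: matrix_exp_apply_def scaleR_right_diff_distrib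
        suminf_diff[OF summable_matrix_exp_series summable_matrix_exp_series])
qed

lemma matrix_exp_apply_has_real_derivative:
  "((\<lambda>t. matrix_exp_apply B t x $ i) has_real_derivative (B *v matrix_exp_apply B t x) $ i) (at t)"
proof -
  define c where "c n = ((*v) B ^^ n) x $ i / fact n" for n
  have "((\<lambda>t. \<Sum>n. c n * t ^ n) has_real_derivative (\<Sum>n. diffs c n * t ^ n)) (at t)"
    unfolding c_def by (intro termdiffs_strong_converges_everywhere summable_matrix_exp_nth)
  moreover have "diffs c n * t ^ n = (\<Sum>l\<in>UNIV. B $ i $ l * (((*v) B ^^ n) x $ l / fact n * t ^ n))" for n
    by (simp add: diffs_def c_def matrix_vector_mult_def sum_distrib_left sum_divide_distrib
        sum_distrib_right mult_ac del: of_nat_Suc)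
  moreover have "(\<Sum>n. \<Sum>l\<in>UNIV. B $ i $ l * (((*v) B ^^ n) x $ l / fact n * t ^ n))
      = (B *v matrix_exp_apply B t x) $ i"
    by (simp only: suminf_sum summable_mult summable_matrix_exp_nth suminf_mult
        matrix_vector_mult_def matrix_exp_apply_nth vec_lambda_beta)
  ultimately show ?thesis
    by (simp only: matrix_exp_apply_nth c_def)
qed

lemma matrix_exp_apply_nonneg:
  assumes "nonneg_mat B" "\<forall>i. 0 \<le> x $ i" "t \<ge> 0"
  shows "0 \<le> matrix_exp_apply B t x $ i"
proof -
  have power_nonneg: "0 \<le> ((*v) B ^^ n) x $ j" for n j
    using assms(1,2) unfolding nonneg_mat_def
    by (induction n arbitrary: j) (auto simp: matrix_vector_mult_def intro!: sum_nonneg)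
  show ?thesis
    unfolding matrix_exp_apply_nth
    by (rule suminf_nonneg[OF summable_matrix_exp_nth]) (use power_nonneg assms(3) in auto)
qed

lemma norm_matrix_exp_apply_le:
  fixes B :: "real^'n^'n"
  obtains K where "K > 0" "\<And>t x. norm (matrix_exp_apply B t x) \<le> exp (K * \<bar>t\<bar>) * norm x"
proof -
  obtain K where K: "K > 0" "\<forall>v. norm (B *v v) \<le> K * norm (v::real^'n)"
    using matrix_vector_mult_bound by blast
  have "norm (matrix_exp_apply B t x) \<le> exp (K * \<bar>t\<bar>) * norm x" for t x
  proof -
    have "norm (matrix_exp_apply B t x) \<le> (\<Sum>n. norm x * ((K * \<bar>t\<bar>) ^ n / fact n))"
      unfolding matrix_exp_apply_def
      by (rule norm_suminf_le[OF _ summable_mult[OF summable_exp_series]])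
        (use norm_matrix_exp_term_le[OF K(2)] K(1) in auto)
    also have "\<dots> = exp (K * \<bar>t\<bar>) * norm x"
      using exp_converges[of "K * \<bar>t\<bar>"]
      by (subst suminf_mult[OF summable_exp_series]) (simp add: sums_iff divide_inverse mult.commute)
    finally show ?thesis .
  qed
  with K(1) that show ?thesis by blast
qed

lemma has_vector_derivative_vec_nth:
  assumes "(y has_vector_derivative y') F"
  shows "((\<lambda>s. y s $ i) has_real_derivative y' $ i) F"
  using bounded_linear.has_vector_derivative[OF bounded_linear_vec_nth assms]
  by (simp add: has_real_derivative_iff_has_vector_derivative)

lemma DERIV_within_nonpos_imp_decreasing:
  fixes f :: "real \<Rightarrow> real"
  assumes "a \<le> b"
    and "\<And>t. t \<in> {a..b} \<Longrightarrow> (f has_real_derivative f' t) (at t within {a..b})"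
    and "\<And>t. t \<in> {a..b} \<Longrightarrow> f' t \<le> 0"
  shows "f b \<le> f a"
proof (rule DERIV_nonpos_imp_decreasing_open[OF assms(1)])
  fix t assume t: "a < t" "t < b"
  then show "\<exists>y. (f has_real_derivative y) (at t) \<and> y \<le> 0"
    using assms(2,3)[of t] at_within_Icc_at[OF t] by auto
next
  show "continuous_on {a..b} f"
    by (rule DERIV_continuous_on[OF assms(2)])
qed

lemma quadratic_form_le:
  fixes A :: "real^'n^'n" and d :: "'n \<Rightarrow> real"
  shows "(\<Sum>i\<in>UNIV. d i * (\<Sum>j\<in>UNIV. A $ i $ j * d j))
      \<le> (\<Sum>i\<in>UNIV. \<Sum>j\<in>UNIV. \<bar>A $ i $ j\<bar>) * (\<Sum>k\<in>UNIV. (d k)\<^sup>2)"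
proof -
  let ?S = "\<Sum>k\<in>UNIV. (d k)\<^sup>2"
  have square_le: "(d k)\<^sup>2 \<le> ?S" for k
    by (rule member_le_sum) auto
  have "d i * (A $ i $ j * d j) \<le> \<bar>A $ i $ j\<bar> * ?S" for i j
  proof -
    have "d i * (A $ i $ j * d j) \<le> \<bar>A $ i $ j\<bar> * (\<bar>d i\<bar> * \<bar>d j\<bar>)"
      by (metis abs_ge_self abs_mult mult.left_commute)
    also have "\<dots> \<le> \<bar>A $ i $ j\<bar> * ?S"
    proof (intro mult_left_mono)
      have "2 * (\<bar>d i\<bar> * \<bar>d j\<bar>) \<le> (d i)\<^sup>2 + (d j)\<^sup>2"
        using sum_squares_bound[of "\<bar>d i\<bar>" "\<bar>d j\<bar>"] by (simp add: power2_eq_square)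
      then show "\<bar>d i\<bar> * \<bar>d j\<bar> \<le> ?S"
        using square_le[of i] square_le[of j] by linarith
    qed simp
    finally show ?thesis .
  qed
  then have "(\<Sum>i\<in>UNIV. \<Sum>j\<in>UNIV. d i * (A $ i $ j * d j)) \<le> (\<Sum>i\<in>UNIV. \<Sum>j\<in>UNIV. \<bar>A $ i $ j\<bar> * ?S)"
    by (intro sum_mono)
  also have "\<dots> = (\<Sum>i\<in>UNIV. \<Sum>j\<in>UNIV. \<bar>A $ i $ j\<bar>) * ?S"
    by (simp only: sum_distrib_right)
  finally show ?thesis
    by (simp add: sum_distrib_left)
qed

text \<open>Uniqueness follows from the Gronwall-type observation that
  \<open>exp (- 2 L s) * norm (y s - z s)\<^sup>2\<close> is nonincreasing, where \<open>L\<close> bounds the quadratic form of \<open>A\<close>.\<close>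
lemma linear_ode_unique:
  fixes A :: "real^'n^'n" and y z :: "real \<Rightarrow> real^'n"
  assumes y: "\<And>s i. s \<in> {a..b} \<Longrightarrow>
      ((\<lambda>s. y s $ i) has_real_derivative (A *v y s) $ i) (at s within {a..b})"
    and z: "\<And>s i. s \<in> {a..b} \<Longrightarrow>
      ((\<lambda>s. z s $ i) has_real_derivative (A *v z s) $ i) (at s within {a..b})"
    and "y a = z a" and t: "t \<in> {a..b}"
  shows "y t = z t"
proof -
  define d where "d s i = y s $ i - z s $ i" for s i
  define L where "L = (\<Sum>i\<in>UNIV. \<Sum>j\<in>UNIV. \<bar>A $ i $ j\<bar>)"
  define g where "g s = exp (- 2 * L * s) * (\<Sum>i\<in>UNIV. (d s i)\<^sup>2)" for s
  have d_deriv: "((\<lambda>s. d s i) has_real_derivative (\<Sum>j\<in>UNIV. A $ i $ j * d s j)) (at s within {a..t})"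
    if "s \<in> {a..t}" for s i
  proof -
    have "s \<in> {a..b}" "{a..t} \<subseteq> {a..b}"
      using that t by auto
    then have "((\<lambda>s. d s i) has_real_derivative (A *v y s) $ i - (A *v z s) $ i) (at s within {a..t})"
      unfolding d_def using DERIV_subset y z by (blast intro: DERIV_diff)
    moreover have "(A *v y s) $ i - (A *v z s) $ i = (\<Sum>j\<in>UNIV. A $ i $ j * d s j)"
      by (simp add: matrix_vector_mult_def d_def sum_subtractf right_diff_distrib)
    ultimately show ?thesis
      by simp
  qed
  define g' where "g' s = exp (- 2 * L * s) *
      (2 * (\<Sum>i\<in>UNIV. d s i * (\<Sum>j\<in>UNIV. A $ i $ j * d s j)) - 2 * L * (\<Sum>i\<in>UNIV. (d s i)\<^sup>2))"
    for s
  have g_deriv: "(g has_real_derivative g' s) (at s within {a..t})" if "s \<in> {a..t}" for s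
    unfolding g_def g'_def
    by (rule derivative_eq_intros DERIV_sum d_deriv[OF that] refl
        | simp add: sum_distrib_left algebra_simps)+
  have g'_nonpos: "g' s \<le> 0" for s
    using quadratic_form_le[of "d s" A] unfolding g'_def L_def
    by (intro mult_nonneg_nonpos) auto
  have "g t \<le> g a"
    by (rule DERIV_within_nonpos_imp_decreasing[OF _ g_deriv g'_nonpos]) (use t in auto)
  moreover have "g a = 0"
    by (simp add: g_def d_def assms(3))
  ultimately have "(\<Sum>i\<in>UNIV. (d t i)\<^sup>2) = 0"
    by (simp add: g_def mult_le_0_iff sum_nonneg order.antisym)
  then have "\<forall>i. (d t i)\<^sup>2 = 0"
    by (simp add: sum_nonneg_eq_0_iff)
  then show ?thesis
    by (simp add: d_def vec_eq_iff)
qed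

lemma matrix_exp_apply_shift_has_real_derivative:
  "((\<lambda>s. matrix_exp_apply A (s - a) x $ i) has_real_derivative
     (A *v matrix_exp_apply A (s - a) x) $ i) (at s within S)"
proof -
  have "((\<lambda>s. s - a) has_real_derivative 1) (at s within S)"
    by (auto intro!: derivative_eq_intros)
  from DERIV_chain2[OF matrix_exp_apply_has_real_derivative this]
  show ?thesis by simp
qed

lemma matrix_exp_apply_add_scaled_id:
  fixes A :: "real^'n^'n"
  assumes "t \<ge> 0"
  shows "matrix_exp_apply A t x = exp (- c * t) *\<^sub>R matrix_exp_apply (A + c *\<^sub>R mat 1) t x"
proof (rule linear_ode_unique[where t = t])
  fix s i
  have "((\<lambda>s. exp (- c * s) * matrix_exp_apply (A + c *\<^sub>R mat 1) s x $ i) has_real_derivative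
      exp (- c * s) * (- c) * matrix_exp_apply (A + c *\<^sub>R mat 1) s x $ i
      + ((A + c *\<^sub>R mat 1) *v matrix_exp_apply (A + c *\<^sub>R mat 1) s x) $ i * exp (- c * s)) (at s)"
    by (rule DERIV_mult[OF _ matrix_exp_apply_has_real_derivative]) (auto intro!: derivative_eq_intros)
  moreover have "((A + c *\<^sub>R mat 1) *v v) $ i = (A *v v) $ i + c * v $ i" for v :: "real^'n"
    by (simp add: matrix_vector_mult_add_rdistrib flip: scaleR_matrix_vector_assoc)
  ultimately show "((\<lambda>s. (exp (- c * s) *\<^sub>R matrix_exp_apply (A + c *\<^sub>R mat 1) s x) $ i) has_real_derivative
      (A *v (exp (- c * s) *\<^sub>R matrix_exp_apply (A + c *\<^sub>R mat 1) s x)) $ i) (at s within {0..t})"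
    by (auto simp: matrix_vector_mult_scaleR algebra_simps intro: has_field_derivative_at_within)
qed (auto intro: has_field_derivative_at_within matrix_exp_apply_has_real_derivative simp: assms)

lemma metzler_matrix_exp_apply_nonneg:
  assumes "metzler A" "\<forall>i. 0 \<le> x $ i" "t \<ge> 0"
  shows "0 \<le> matrix_exp_apply A t x $ i"
proof -
  define c where "c = (\<Sum>k\<in>UNIV. \<bar>A $ k $ k\<bar>)"
  have "nonneg_mat (A + c *\<^sub>R mat 1)"
    unfolding nonneg_mat_def
  proof (intro allI)
    fix i j
    have "\<bar>A $ i $ i\<bar> \<le> c"
      unfolding c_def by (rule member_le_sum) auto
    then show "0 \<le> (A + c *\<^sub>R mat 1) $ i $ j"
      using assms(1) by (auto simp: metzler_def mat_def)
  qed
  then have "0 \<le> matrix_exp_apply (A + c *\<^sub>R mat 1) t x $ i"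
    using matrix_exp_apply_nonneg assms(2,3) by blast
  then show ?thesis
    using matrix_exp_apply_add_scaled_id[OF assms(3), of A x c] by simp
qed

lemma impulsive_solution_eq_iterated_flow:
  assumes sol: "impulsive_solution A J T x" and "T > 0"
    and t: "t \<in> {real k * T <.. real (Suc k) * T}"
  shows "x t = matrix_exp_apply A (t - real k * T) (((\<lambda>v. J *v matrix_exp_apply A T v) ^^ k) (x 0))"
proof -
  define p where "p k = (if k = 0 then x 0 else J *v x (real k * T))" for k
  have on_interval: "x t = matrix_exp_apply A (t - real k * T) (p k)"
    if "t \<in> {real k * T <.. real (Suc k) * T}" for k t
  proof -
    obtain y where y: "\<forall>t\<in>{real k * T .. real (Suc k) * T}.
        (y has_vector_derivative (A *v y t)) (at t within {real k * T .. real (Suc k) * T})"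
      and "y (real k * T) = p k" and "\<forall>t\<in>{real k * T <.. real (Suc k) * T}. x t = y t"
      using sol unfolding impulsive_solution_def p_def by blast
    moreover have "y t = matrix_exp_apply A (t - real k * T) (y (real k * T))"
      by (rule linear_ode_unique[where a = "real k * T" and b = "real (Suc k) * T"])
        (use y that in \<open>auto intro: has_vector_derivative_vec_nth
           matrix_exp_apply_shift_has_real_derivative\<close>)
    ultimately show ?thesis
      using that by auto
  qed
  have "p (Suc k) = J *v matrix_exp_apply A T (p k)" for k
  proof -
    have "real k * T < real (Suc k) * T" "real (Suc k) * T - real k * T = T"
      using \<open>T > 0\<close> by (auto simp: algebra_simps)
    then show ?thesis
      using on_interval[of "real (Suc k) * T" k] by (simp add: p_def)
  qed
  then have "p k = ((\<lambda>v. J *v matrix_exp_apply A T v) ^^ k) (x 0)" for k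
    by (induction k) (simp_all add: p_def)
  then show ?thesis
    using on_interval[OF t] by simp
qed

lemma copositive_lyapunov_decrease:
  fixes A :: "real^'n^'n" and \<zeta> \<zeta>' P :: "real \<Rightarrow> real^'n"
  assumes "T \<ge> 0"
    and \<zeta>_deriv: "\<And>s j. ((\<lambda>s. \<zeta> s $ j) has_real_derivative \<zeta>' s $ j) (at s)"
    and decrease: "\<forall>\<tau>\<in>{0..T}. \<forall>j. (\<zeta> \<tau> v* A) $ j \<le> \<zeta>' \<tau> $ j"
    and P_nonneg: "\<forall>s\<in>{0..T}. \<forall>j. 0 \<le> P s $ j"
    and P_deriv: "\<And>s j. ((\<lambda>s. P s $ j) has_real_derivative (A *v P s) $ j) (at s)"
  shows "\<zeta> 0 \<bullet> P T \<le> \<zeta> T \<bullet> P 0"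
proof -
  define V where "V s = (\<Sum>j\<in>UNIV. \<zeta> (T - s) $ j * P s $ j)" for s
  define V' where "V' s = (\<Sum>j\<in>UNIV. - \<zeta>' (T - s) $ j * P s $ j + (A *v P s) $ j * \<zeta> (T - s) $ j)"
    for s
  have V_deriv: "(V has_real_derivative V' s) (at s)" for s
  proof -
    have "((\<lambda>s. T - s) has_real_derivative -1) (at s)"
      by (auto intro!: derivative_eq_intros)
    from DERIV_chain2[OF \<zeta>_deriv this]
    have "((\<lambda>s. \<zeta> (T - s) $ j) has_real_derivative - \<zeta>' (T - s) $ j) (at s)" for j
      by simp
    then show ?thesis
      unfolding V_def V'_def by (intro DERIV_sum DERIV_mult P_deriv)
  qed
  have V'_nonpos: "V' s \<le> 0" if "s \<in> {0..T}" for s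
  proof -
    have "V' s = \<zeta> (T - s) \<bullet> (A *v P s) - \<zeta>' (T - s) \<bullet> P s"
      by (simp add: V'_def inner_vec_def sum_subtractf mult_ac)
    also have "\<dots> = (\<zeta> (T - s) v* A - \<zeta>' (T - s)) \<bullet> P s"
      by (simp add: inner_diff_left dot_lmul_matrix)
    also have "\<dots> \<le> 0"
      unfolding inner_vec_def
      using that decrease P_nonneg by (auto intro!: sum_nonpos mult_nonpos_nonneg)
    finally show ?thesis .
  qed
  have "V T \<le> V 0"
    by (rule DERIV_within_nonpos_imp_decreasing[where f = V and f' = V', OF _ _ V'_nonpos])
      (auto intro: has_field_derivative_at_within V_deriv simp: \<open>T \<ge> 0\<close>)
  then show ?thesis
    by (simp add: V_def inner_vec_def)
qed

lemma norm_le_inner_div: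
  fixes v w :: "real^'n"
  assumes "\<forall>i. \<epsilon> \<le> w $ i" and "\<epsilon> > 0" and "\<forall>i. 0 \<le> v $ i"
  shows "norm v \<le> (w \<bullet> v) / \<epsilon>"
proof -
  have "\<epsilon> * norm v \<le> (\<Sum>i\<in>UNIV. \<epsilon> * \<bar>v $ i\<bar>)"
    unfolding sum_distrib_left[symmetric]
    by (intro mult_left_mono norm_le_l1_cart) (use \<open>\<epsilon> > 0\<close> in auto)
  also have "\<dots> \<le> w \<bullet> v"
    unfolding inner_vec_def using assms(1,3) by (auto intro!: sum_mono mult_right_mono)
  finally show ?thesis
    using \<open>\<epsilon> > 0\<close> by (simp add: pos_le_divide_eq mult.commute)
qed

lemma positive_contraction_funpow:
  fixes M :: "real^'n \<Rightarrow> real^'n" and w :: "real^'n"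
  assumes M_pos: "\<And>z. \<forall>i. 0 \<le> z $ i \<Longrightarrow> \<forall>i. 0 \<le> M z $ i"
    and M_contr: "\<And>z. \<forall>i. 0 \<le> z $ i \<Longrightarrow> w \<bullet> M z \<le> \<rho> * (w \<bullet> z)"
    and "0 \<le> \<rho>" and "\<forall>i. 0 \<le> z $ i"
  shows "(\<forall>i. 0 \<le> (M ^^ k) z $ i) \<and> w \<bullet> (M ^^ k) z \<le> \<rho> ^ k * (w \<bullet> z)"
proof (induction k)
  case (Suc k)
  then have "w \<bullet> (M ^^ Suc k) z \<le> \<rho> * (\<rho> ^ k * (w \<bullet> z))"
    using M_contr[of "(M ^^ k) z"] \<open>0 \<le> \<rho>\<close> by (auto intro: order_trans mult_left_mono)
  with Suc M_pos show ?case
    by (simp add: mult.assoc)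
qed (use assms(4) in simp)

text \<open>An arbitrary state is the difference of its positive and negative parts, each dominated
  componentwise by it.\<close>
lemma positive_contraction_geometric_decay:
  fixes M :: "real^'n \<Rightarrow> real^'n" and w :: "real^'n"
  assumes M_diff: "\<And>a b. M (a - b) = M a - M b"
    and M_pos: "\<And>z. \<forall>i. 0 \<le> z $ i \<Longrightarrow> \<forall>i. 0 \<le> M z $ i"
    and M_contr: "\<And>z. \<forall>i. 0 \<le> z $ i \<Longrightarrow> w \<bullet> M z \<le> \<rho> * (w \<bullet> z)"
    and w_pos: "\<forall>i. 0 < w $ i" and "0 \<le> \<rho>"
  obtains C where "C \<ge> 0" "\<And>k x. norm ((M ^^ k) x) \<le> C * \<rho> ^ k * norm x"
proof -
  define \<epsilon> where "\<epsilon> = Min (range (\<lambda>i. w $ i))"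
  have "\<epsilon> > 0" "\<forall>i. \<epsilon> \<le> w $ i"
    using w_pos by (auto simp: \<epsilon>_def)
  have positive_part_bound: "norm ((M ^^ k) u) \<le> norm w / \<epsilon> * \<rho> ^ k * norm x"
    if "\<forall>i. 0 \<le> u $ i" "\<forall>i. \<bar>u $ i\<bar> \<le> \<bar>x $ i\<bar>" for k u x
  proof -
    note iterate = positive_contraction_funpow[OF M_pos M_contr \<open>0 \<le> \<rho>\<close> that(1)]
    have "norm u \<le> norm x"
      using norm_le_componentwise_cart[of u x] that(2) by simp
    then have "w \<bullet> u \<le> norm w * norm x"
      using norm_cauchy_schwarz[of w u] by (meson order_trans mult_left_mono norm_ge_zero)
    have "norm ((M ^^ k) u) \<le> \<rho> ^ k * (w \<bullet> u) / \<epsilon>"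
      using norm_le_inner_div[OF \<open>\<forall>i. \<epsilon> \<le> w $ i\<close> \<open>\<epsilon> > 0\<close>] iterate \<open>\<epsilon> > 0\<close>
      by (meson divide_right_mono order_trans less_imp_le)
    also have "\<dots> \<le> \<rho> ^ k * (norm w * norm x) / \<epsilon>"
      using \<open>w \<bullet> u \<le> norm w * norm x\<close> \<open>\<epsilon> > 0\<close> \<open>0 \<le> \<rho>\<close>
      by (intro divide_right_mono mult_left_mono) auto
    finally show ?thesis
      by (simp add: mult_ac)
  qed
  have "norm ((M ^^ k) x) \<le> 2 * norm w / \<epsilon> * \<rho> ^ k * norm x" for k x
  proof -
    define xp where "xp = (\<chi> i. max (x $ i) 0)"
    define xn where "xn = (\<chi> i. max (- x $ i) 0)"
    have "(M ^^ k) (a - b) = (M ^^ k) a - (M ^^ k) b" for a b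
      by (induction k) (simp_all add: M_diff)
    moreover have "x = xp - xn"
      by (simp add: xp_def xn_def vec_eq_iff max_def)
    ultimately have "norm ((M ^^ k) x) \<le> norm ((M ^^ k) xp) + norm ((M ^^ k) xn)"
      by (metis norm_triangle_ineq4)
    also have "\<dots> \<le> norm w / \<epsilon> * \<rho> ^ k * norm x + norm w / \<epsilon> * \<rho> ^ k * norm x"
      by (intro add_mono positive_part_bound) (auto simp: xp_def xn_def)
    finally show ?thesis
      by (simp add: mult_ac)
  qed
  with \<open>\<epsilon> > 0\<close> that show ?thesis
    by (metis divide_nonneg_pos mult_nonneg_nonneg norm_ge_zero zero_le_numeral)
qed

lemma exists_dwell_interval:
  fixes t T :: real
  assumes "t > 0" and "T > 0"
  obtains k :: nat where "t \<in> {real k * T <.. real (Suc k) * T}"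
proof -
  define k where "k = nat (\<lceil>t / T\<rceil> - 1)"
  have "0 < t / T"
    using assms by simp
  then have "real k = real_of_int \<lceil>t / T\<rceil> - 1"
    unfolding k_def by (simp add: of_nat_nat)
  then have "real k < t / T" "t / T \<le> real (Suc k)"
    by linarith+
  then show ?thesis
    using that \<open>T > 0\<close> by (simp add: pos_less_divide_eq pos_divide_le_eq)
qed

lemma impulsive_solution_bounded_if_geometric_decay:
  fixes A J :: "real^'n^'n"
  assumes "T > 0" "0 \<le> \<rho>" "\<rho> < 1" "0 \<le> D"
    and decay: "\<And>x k t. impulsive_solution A J T x \<Longrightarrow> t \<in> {real k * T <.. real (Suc k) * T} \<Longrightarrow>
      norm (x t) \<le> D * \<rho> ^ k * norm (x 0)"
    and "impulsive_solution A J T x" "t \<ge> 0"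
  shows "norm (x t) \<le> max 1 D * norm (x 0)"
proof (cases "t = 0")
  case False
  then obtain k where "t \<in> {real k * T <.. real (Suc k) * T}"
    using exists_dwell_interval \<open>t \<ge> 0\<close> \<open>T > 0\<close> by (metis less_eq_real_def)
  then have "norm (x t) \<le> D * \<rho> ^ k * norm (x 0)"
    using decay \<open>impulsive_solution A J T x\<close> by blast
  also have "\<dots> \<le> max 1 D * norm (x 0)"
  proof (intro mult_right_mono)
    have "\<rho> ^ k \<le> 1"
      using assms(2,3) by (simp add: power_le_one)
    then show "D * \<rho> ^ k \<le> max 1 D"
      using \<open>0 \<le> D\<close> by (metis max.coboundedI2 mult_left_le)
  qed simp
  finally show ?thesis .
qed (use mult_right_mono[of 1 "max 1 D" "norm (x 0)"] in simp)

lemma impulsive_solution_tendsto_0_if_geometric_decay: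
  fixes A J :: "real^'n^'n"
  assumes "T > 0" "0 \<le> \<rho>" "\<rho> < 1" "0 \<le> D"
    and decay: "\<And>k t. t \<in> {real k * T <.. real (Suc k) * T} \<Longrightarrow> norm (x t) \<le> D * \<rho> ^ k * norm (x 0)"
  shows "(x \<longlongrightarrow> 0) at_top"
proof (rule tendstoI)
  fix e :: real
  assume "e > 0"
  define a where "a = D * norm (x 0)"
  have "a \<ge> 0"
    using \<open>0 \<le> D\<close> by (simp add: a_def)
  obtain N where N: "\<rho> ^ N < e / (a + 1)"
    using real_arch_pow_inv[OF _ \<open>\<rho> < 1\<close>, of "e / (a + 1)"] \<open>e > 0\<close> \<open>a \<ge> 0\<close> by auto
  show "eventually (\<lambda>t. dist (x t) 0 < e) at_top"
    using eventually_gt_at_top[of "real N * T"]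
  proof (rule eventually_mono)
    fix t
    assume "t > real N * T"
    then have "t > 0"
      using \<open>T > 0\<close> by (smt (verit) mult_nonneg_nonneg of_nat_0_le_iff)
    then obtain k where k: "t \<in> {real k * T <.. real (Suc k) * T}"
      using exists_dwell_interval \<open>T > 0\<close> by blast
    with \<open>t > real N * T\<close> have "real N * T < real (Suc k) * T"
      by auto
    then have "N \<le> k"
      using \<open>T > 0\<close> by (simp add: mult_less_cancel_right)
    then have "\<rho> ^ k \<le> \<rho> ^ N"
      using assms(2,3) by (intro power_decreasing) auto
    then have "a * \<rho> ^ k \<le> a * \<rho> ^ N"
      using \<open>a \<ge> 0\<close> by (rule mult_left_mono)
    then have "norm (x t) \<le> a * \<rho> ^ N"
      using decay[OF k] by (simp add: a_def mult_ac)
    also have "\<dots> \<le> a * (e / (a + 1))"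
      using N \<open>a \<ge> 0\<close> by (intro mult_left_mono) auto
    also have "\<dots> < e"
      using \<open>a \<ge> 0\<close> \<open>e > 0\<close> by (simp add: field_simps)
    finally show "dist (x t) 0 < e"
      by simp
  qed
qed

lemma impulsive_GAS_if_geometric_decay:
  fixes A J :: "real^'n^'n"
  assumes "T > 0" "0 \<le> \<rho>" "\<rho> < 1" "0 \<le> D"
    and decay: "\<And>x k t. impulsive_solution A J T x \<Longrightarrow> t \<in> {real k * T <.. real (Suc k) * T} \<Longrightarrow>
      norm (x t) \<le> D * \<rho> ^ k * norm (x 0)"
  shows "impulsive_GAS A J T"
proof -
  note bounded = impulsive_solution_bounded_if_geometric_decay[OF assms]
  have "\<exists>d>0. \<forall>x. impulsive_solution A J T x \<and> norm (x 0) < d \<longrightarrow> (\<forall>t\<ge>0. norm (x t) < e)"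
    if "e > 0" for e :: real
  proof (intro exI[of _ "e / max 1 D"] conjI allI impI)
    fix x and t :: real
    assume "impulsive_solution A J T x \<and> norm (x 0) < e / max 1 D" "0 \<le> t"
    then have "norm (x t) \<le> max 1 D * norm (x 0)" "max 1 D * norm (x 0) < e"
      using bounded by (auto simp: pos_less_divide_eq mult.commute)
    then show "norm (x t) < e"
      by linarith
  qed (use that in simp)
  moreover have "(x \<longlongrightarrow> 0) at_top" if "impulsive_solution A J T x" for x
    using impulsive_solution_tendsto_0_if_geometric_decay[OF assms(1-4)] decay[OF that] by blast
  ultimately show ?thesis
    unfolding impulsive_GAS_def by blast
qed

lemma norm_impulsive_solution_le_jump_iterate:
  fixes A J :: "real^'n^'n"
  assumes "T > 0"
  obtains K where "K \<ge> 0" and "\<And>x k t. impulsive_solution A J T x \<Longrightarrow>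
      t \<in> {real k * T <.. real (Suc k) * T} \<Longrightarrow>
      norm (x t) \<le> K * norm (((\<lambda>v. J *v matrix_exp_apply A T v) ^^ k) (x 0))"
proof -
  obtain L where "L > 0" and L: "\<And>t x. norm (matrix_exp_apply A t x) \<le> exp (L * \<bar>t\<bar>) * norm x"
    using norm_matrix_exp_apply_le by blast
  have "norm (x t) \<le> exp (L * T) * norm (((\<lambda>v. J *v matrix_exp_apply A T v) ^^ k) (x 0))"
    if sol: "impulsive_solution A J T x" and t: "t \<in> {real k * T <.. real (Suc k) * T}" for x k t
  proof -
    have "\<bar>t - real k * T\<bar> \<le> T"
      using t by (auto simp: algebra_simps)
    then have "exp (L * \<bar>t - real k * T\<bar>) \<le> exp (L * T)"
      using \<open>L > 0\<close> by simp
    then show ?thesis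
      unfolding impulsive_solution_eq_iterated_flow[OF sol \<open>T > 0\<close> t]
      by (meson L mult_right_mono norm_ge_zero order_trans)
  qed
  then show ?thesis
    using that[of "exp (L * T)"] by simp
qed

lemma exists_ratio_bound_lt_1:
  fixes u v :: "real^'n"
  assumes "\<forall>j. 0 \<le> u $ j" and "\<forall>j. u $ j < v $ j"
  obtains \<rho> where "0 \<le> \<rho>" "\<rho> < 1" "\<forall>j. u $ j \<le> \<rho> * v $ j"
proof -
  have v_pos: "0 < v $ j" for j
    using assms le_less_trans by blast
  define \<rho> where "\<rho> = Max (range (\<lambda>j. u $ j / v $ j))"
  have ratio_le: "u $ j / v $ j \<le> \<rho>" for j
    unfolding \<rho>_def by (rule Max_ge) auto
  show ?thesis
  proof
    show "0 \<le> \<rho>"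
      using order_trans[OF divide_nonneg_pos ratio_le] assms(1) v_pos by blast
    show "\<rho> < 1"
      unfolding \<rho>_def using assms(2) v_pos by (simp add: Max_less_iff)
    show "\<forall>j. u $ j \<le> \<rho> * v $ j"
      using ratio_le v_pos by (simp add: pos_divide_le_eq mult.commute)
  qed
qed

lemma copositive_flow_jump_contraction:
  fixes A J :: "real^'n^'n" and \<zeta> \<zeta>' :: "real \<Rightarrow> real^'n"
  assumes "metzler A" and "T \<ge> 0"
    and \<zeta>_deriv: "\<And>s j. ((\<lambda>s. \<zeta> s $ j) has_real_derivative \<zeta>' s $ j) (at s)"
    and decrease: "\<forall>\<tau>\<in>{0..T}. \<forall>j. (\<zeta> \<tau> v* A) $ j \<le> \<zeta>' \<tau> $ j"
    and "0 \<le> \<rho>" and jump: "\<forall>j. (\<zeta> T v* J) $ j \<le> \<rho> * \<zeta> 0 $ j"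
    and z: "\<forall>i. 0 \<le> z $ i"
  shows "\<zeta> T \<bullet> (J *v matrix_exp_apply A T z) \<le> \<rho> * (\<zeta> T \<bullet> z)"
proof -
  let ?y = "matrix_exp_apply A T z"
  have y_nonneg: "\<forall>s\<in>{0..T}. \<forall>j. 0 \<le> matrix_exp_apply A s z $ j"
    using metzler_matrix_exp_apply_nonneg[OF assms(1) z] by auto
  have "\<zeta> T \<bullet> (J *v ?y) = (\<zeta> T v* J) \<bullet> ?y"
    by (simp add: dot_lmul_matrix)
  also have "\<dots> \<le> (\<rho> *\<^sub>R \<zeta> 0) \<bullet> ?y"
    unfolding inner_vec_def using jump y_nonneg \<open>T \<ge> 0\<close>
    by (auto intro!: sum_mono mult_right_mono)
  also have "\<dots> \<le> \<rho> * (\<zeta> T \<bullet> z)"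
    using copositive_lyapunov_decrease[OF \<open>T \<ge> 0\<close> \<zeta>_deriv decrease y_nonneg
        matrix_exp_apply_has_real_derivative] \<open>0 \<le> \<rho>\<close>
    by (simp add: mult_left_mono)
  finally show ?thesis .
qed

lemma impulsive_GAS_if_copositive_lyapunov:
  fixes A J :: "real^'n^'n" and \<zeta> \<zeta>' :: "real \<Rightarrow> real^'n"
  assumes "metzler A" and "nonneg_mat J" and "T > 0"
    and \<zeta>_deriv: "\<And>s j. ((\<lambda>s. \<zeta> s $ j) has_real_derivative \<zeta>' s $ j) (at s)"
    and decrease: "\<forall>\<tau>\<in>{0..T}. \<forall>j. (\<zeta> \<tau> v* A) $ j \<le> \<zeta>' \<tau> $ j"
    and pos: "\<forall>j. 0 < \<zeta> T $ j"
    and jump: "\<forall>j. (\<zeta> T v* J) $ j < \<zeta> 0 $ j"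
  shows "impulsive_GAS A J T"
proof -
  define M where "M = (\<lambda>v. J *v matrix_exp_apply A T v)"
  have J_nonneg: "0 \<le> (J *v v) $ i" if "\<forall>i. 0 \<le> v $ i" for v i
    using assms(2) that by (auto simp: matrix_vector_mult_def nonneg_mat_def intro!: sum_nonneg)
  have "\<forall>j. 0 \<le> (\<zeta> T v* J) $ j"
    using assms(2) pos
    by (auto simp: vector_matrix_mult_def nonneg_mat_def less_imp_le intro!: sum_nonneg)
  then obtain \<rho> where "0 \<le> \<rho>" "\<rho> < 1" and jump_le: "\<forall>j. (\<zeta> T v* J) $ j \<le> \<rho> * \<zeta> 0 $ j"
    using exists_ratio_bound_lt_1 jump by blast
  have M_diff: "M (a - b) = M a - M b" for a b
    by (simp add: M_def matrix_exp_apply_diff matrix_vector_mult_diff_distrib)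
  have M_pos: "\<forall>i. 0 \<le> M z $ i" if "\<forall>i. 0 \<le> z $ i" for z
    using metzler_matrix_exp_apply_nonneg[OF assms(1) that] \<open>T > 0\<close>
    by (simp add: M_def J_nonneg)
  have M_contr: "\<zeta> T \<bullet> M z \<le> \<rho> * (\<zeta> T \<bullet> z)" if "\<forall>i. 0 \<le> z $ i" for z
    unfolding M_def using copositive_flow_jump_contraction[OF assms(1) _ \<zeta>_deriv decrease
        \<open>0 \<le> \<rho>\<close> jump_le that] \<open>T > 0\<close> by simp
  obtain C where "C \<ge> 0" and C: "\<And>k x. norm ((M ^^ k) x) \<le> C * \<rho> ^ k * norm x"
    using positive_contraction_geometric_decay[OF M_diff M_pos M_contr pos \<open>0 \<le> \<rho>\<close>] by blast
  obtain K where "K \<ge> 0" and K: "\<And>x k t. impulsive_solution A J T x \<Longrightarrow>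
      t \<in> {real k * T <.. real (Suc k) * T} \<Longrightarrow> norm (x t) \<le> K * norm ((M ^^ k) (x 0))"
    using norm_impulsive_solution_le_jump_iterate[OF \<open>T > 0\<close>] unfolding M_def by blast
  show ?thesis
  proof (rule impulsive_GAS_if_geometric_decay[OF \<open>T > 0\<close> \<open>0 \<le> \<rho>\<close> \<open>\<rho> < 1\<close>])
    show "0 \<le> K * C"
      using \<open>K \<ge> 0\<close> \<open>C \<ge> 0\<close> by simp
    show "norm (x t) \<le> K * C * \<rho> ^ k * norm (x 0)"
      if "impulsive_solution A J T x" "t \<in> {real k * T <.. real (Suc k) * T}" for x k t
    proof -
      have "norm (x t) \<le> K * norm ((M ^^ k) (x 0))"
        using K[OF that] .
      also have "\<dots> \<le> K * (C * \<rho> ^ k * norm (x 0))"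
        using C \<open>K \<ge> 0\<close> by (rule mult_left_mono)
      finally show ?thesis
        by (simp add: mult_ac)
    qed
  qed
qed

lemma sos_poly_nonneg:
  assumes "sos_poly p"
  shows "0 \<le> poly p x"
proof -
  obtain qs where "p = (\<Sum>q\<leftarrow>qs. q ^ 2)"
    using assms unfolding sos_poly_def by blast
  moreover have "0 \<le> poly (\<Sum>q\<leftarrow>qs. q ^ 2) x"
    by (induction qs) auto
  ultimately show ?thesis
    by simp
qed

text \<open>The multiplier \<open>[:0, T, -1:]\<close> is \<open>\<tau> (T - \<tau>)\<close>, nonnegative exactly on \<open>[0, T]\<close>.\<close>
lemma sos_certificate_imp_decrease:
  fixes A :: "real^'n^'n" and \<zeta> \<gamma> :: "real poly ^ 'n"
  assumes "csos \<gamma>"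
    and "csos (\<chi> j. - (\<Sum>i\<in>UNIV. smult (A $ i $ j) (\<zeta> $ i)) + pderiv (\<zeta> $ j)
                      - [:0, T, -1:] * (\<gamma> $ j))"
    and "\<tau> \<in> {0..T}"
  shows "(\<Sum>i\<in>UNIV. poly (\<zeta> $ i) \<tau> * A $ i $ j) - poly (pderiv (\<zeta> $ j)) \<tau> \<le> 0"
proof -
  have "0 \<le> - (\<Sum>i\<in>UNIV. poly (\<zeta> $ i) \<tau> * A $ i $ j) + poly (pderiv (\<zeta> $ j)) \<tau>
      - \<tau> * (T - \<tau>) * poly (\<gamma> $ j) \<tau>"
    using sos_poly_nonneg[of _ \<tau>] assms(2) unfolding csos_def
    by (fastforce simp: poly_sum algebra_simps)
  moreover have "0 \<le> \<tau> * (T - \<tau>) * poly (\<gamma> $ j) \<tau>"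
    using sos_poly_nonneg assms(1,3) unfolding csos_def by auto
  ultimately show ?thesis
    by linarith
qed

theorem proposition6:
  fixes A J :: "real ^ 'n ^ 'n"
    and Tb :: real and ds :: nat and \<epsilon>1 \<epsilon>2 :: real
    and \<zeta> \<gamma> :: "real poly ^ 'n"
  assumes "metzler A" and "nonneg_mat J" and "Tb > 0" and "\<epsilon>1 > 0" and "\<epsilon>2 > 0"
    and "\<forall>i. degree (\<zeta> $ i) \<le> 2 * ds" and "\<forall>i. degree (\<gamma> $ i) \<le> 2 * ds"
    and "csos \<gamma>"
    and "\<forall>i. poly (\<zeta> $ i) Tb - \<epsilon>2 \<ge> 0"
    and "csos (\<chi> j. - (\<Sum>i\<in>UNIV. smult (A $ i $ j) (\<zeta> $ i)) + pderiv (\<zeta> $ j)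
                      - [:0, Tb, -1:] * (\<gamma> $ j))"
    and "\<forall>j. - (\<Sum>i\<in>UNIV. poly (\<zeta> $ i) Tb * J $ i $ j) + poly (\<zeta> $ j) 0 - \<epsilon>1 \<ge> 0"
  shows "(\<forall>i. poly (\<zeta> $ i) Tb > 0)
    \<and> (\<forall>\<tau>\<in>{0..Tb}. \<forall>j. (\<Sum>i\<in>UNIV. poly (\<zeta> $ i) \<tau> * A $ i $ j) - poly (pderiv (\<zeta> $ j)) \<tau> \<le> 0)
    \<and> (\<forall>j. (\<Sum>i\<in>UNIV. poly (\<zeta> $ i) Tb * J $ i $ j) - poly (\<zeta> $ j) 0 + \<epsilon>1 \<le> 0)
    \<and> impulsive_GAS A J Tb"
proof -
  have pos: "\<forall>i. poly (\<zeta> $ i) Tb > 0"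
    using assms(5,9) by (auto intro: less_le_trans)
  have decrease: "\<forall>\<tau>\<in>{0..Tb}. \<forall>j. (\<Sum>i\<in>UNIV. poly (\<zeta> $ i) \<tau> * A $ i $ j) - poly (pderiv (\<zeta> $ j)) \<tau> \<le> 0"
    using sos_certificate_imp_decrease[OF assms(8,10)] by blast
  have jump: "\<forall>j. (\<Sum>i\<in>UNIV. poly (\<zeta> $ i) Tb * J $ i $ j) - poly (\<zeta> $ j) 0 + \<epsilon>1 \<le> 0"
    using assms(11) by (auto simp: algebra_simps)
  have strict_jump: "(\<Sum>i\<in>UNIV. poly (\<zeta> $ i) Tb * J $ i $ j) < poly (\<zeta> $ j) 0" for j
    using jump[rule_format, of j] assms(4) by linarith
  have "impulsive_GAS A J Tb"
    by (rule impulsive_GAS_if_copositive_lyapunov[OF assms(1-3),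
          where \<zeta> = "\<lambda>s. \<chi> i. poly (\<zeta> $ i) s" and \<zeta>' = "\<lambda>s. \<chi> i. poly (pderiv (\<zeta> $ i)) s"])
      (use pos decrease strict_jump in \<open>auto simp: vector_matrix_mult_def\<close>)
  with pos decrease jump show ?thesis
    by blast
qed

end
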